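(* For problem (D) with $\Psi_\mu=\Psi_{+,\mu}$: (i) every stationary point of (D) is a local minimizer of $G$; (ii) if $w^*=[y^*;z^*]$ is a local minimizer of $G$ with $G(w^* )<\infty$ and the Slater condition $$\{w=[y;z]:\ -A^\top y-B^\top z\in\operatorname{ri}(\operatorname{dom}f^* ),\ y\in\operatorname{ri}(\operatorname{dom}g^* ),\ z_{\bar T_*}=0,\ z_{T_*}\ge0\}\neq\emptyset$$ holds, where $T_*=\{i:z^*_i\ne0\}$, $\bar T_*=[r]\setminus T_*$, and "$\operatorname{ri}$" may be omitted for $f^*$ (resp. $g^*$) when it is polyhedral, then $w^*$ is a stationary point of (D).
   Context: Let $f:\mathbb R^n\to(-\infty,\infty]$, $g:\mathbb R^m\to(-\infty,\infty]$ be proper, lsc and convex with conjugates $f^*,g^*$; $A\in\mathbb R^{m\times n}$, $B\in\mathbb R^{r\times n}$, $b\in\mathbb R^r$, $\mu\in\mathbb R^r$, $\mu>0$. For $w=[y;z]\in\mathbb R^m\times\mathbb R^r$: $\Xi(w)=f^*(-A^\top y-B^\top z)+g^*(y)+\langle b,z\rangle$, $\Psi_{+,\mu}(z)=\sum_i\mu_i\mathbf 1_{\{z_i\neq0\}}+\delta(z\mid\mathbb R^r_+)$, and (D) is $\min_w G(w)=\Xi(w)+\Psi_{+,\mu}(z)$. $\partial$ is the limiting subdifferential; $\partial\Psi_{+,\mu}(z)=\{u:u_i\in\mathbb R\text{ if }z_i=0,\ u_i=0\text{ otherwise}\}$ for $z\ge0$ and $\emptyset$ otherwise. $w^*$ is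 a stationary point of (D) if there exist $x\in\partial f^*(-A^\top y^*-B^\top z^* )$, $v\in\partial g^*(y^* )$, $u\in\partial\Psi_{+,\mu}(z^* )$ with $Ax=v$ and $Bx=b+u$. $\operatorname{ri}$ denotes relative interior. *)

theory Defs
  imports "HOL-Analysis.Analysis" "HOL-Library.Extended_Real"
begin

definition proper_fun :: "('a \<Rightarrow> ereal) \<Rightarrow> bool" where
  "proper_fun h \<longleftrightarrow> (\<forall>x. h x \<noteq> -\<infinity>) \<and> (\<exists>x. h x < \<infinity>)"

definition lsc_fun :: "('a::topological_space \<Rightarrow> ereal) \<Rightarrow> bool" where
  "lsc_fun h \<longleftrightarrow> (\<forall>x. h x \<le> Liminf (at x) h)"

definition convex_fun :: "('a::real_vector \<Rightarrow> ereal) \<Rightarrow> bool" where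
  "convex_fun h \<longleftrightarrow> (\<forall>x y t. 0 \<le> t \<and> t \<le> 1 \<longrightarrow>
      h ((1 - t) *\<^sub>R x + t *\<^sub>R y) \<le> ereal (1 - t) * h x + ereal t * h y)"

definition edom :: "('a \<Rightarrow> ereal) \<Rightarrow> 'a set" where
  "edom h = {x. h x < \<infinity>}"

definition conj_fun :: "('a::real_inner \<Rightarrow> ereal) \<Rightarrow> 'a \<Rightarrow> ereal" where
  "conj_fun h u = (SUP x. ereal (inner u x) - h x)"

definition polyhedral_fun :: "('a::euclidean_space \<Rightarrow> ereal) \<Rightarrow> bool" where
  "polyhedral_fun h \<longleftrightarrow> polyhedron {(x, t::real). h x \<le> ereal t}"

definition frechet_subdiff :: "('a::real_inner \<Rightarrow> ereal) \<Rightarrow> 'a \<Rightarrow> 'a set" where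
  "frechet_subdiff h x = {v. \<bar>h x\<bar> \<noteq> \<infinity> \<and>
      (\<forall>e>0. \<exists>d>0. \<forall>x'. norm (x' - x) < d \<longrightarrow>
         ereal (real_of_ereal (h x) + inner v (x' - x) - e * norm (x' - x)) \<le> h x')}"

definition limiting_subdiff :: "('a::real_inner \<Rightarrow> ereal) \<Rightarrow> 'a \<Rightarrow> 'a set" where
  "limiting_subdiff h x = {v. \<exists>xs vs. xs \<longlonglongrightarrow> x \<and> (\<lambda>k. h (xs k)) \<longlonglongrightarrow> h x \<and>
      (\<forall>k. vs k \<in> frechet_subdiff h (xs k)) \<and> vs \<longlonglongrightarrow> v}"

definition Psi_plus :: "real^'r \<Rightarrow> real^'r \<Rightarrow> ereal" where
  "Psi_plus \<mu> z = (if (\<forall>i. 0 \<le> z $ i)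
       then ereal (\<Sum>i\<in>UNIV. if z $ i \<noteq> 0 then \<mu> $ i else 0) else \<infinity>)"

definition Xi_fun :: "(real^'n \<Rightarrow> ereal) \<Rightarrow> (real^'m \<Rightarrow> ereal) \<Rightarrow> real^'n^'m \<Rightarrow> real^'n^'r
     \<Rightarrow> real^'r \<Rightarrow> (real^'m) \<times> (real^'r) \<Rightarrow> ereal" where
  "Xi_fun f g A B b w = (case w of (y, z) \<Rightarrow>
      conj_fun f (- (transpose A *v y) - (transpose B *v z)) + conj_fun g y + ereal (inner b z))"

definition G_fun :: "(real^'n \<Rightarrow> ereal) \<Rightarrow> (real^'m \<Rightarrow> ereal) \<Rightarrow> real^'n^'m \<Rightarrow> real^'n^'r
     \<Rightarrow> real^'r \<Rightarrow> real^'r \<Rightarrow> (real^'m) \<times> (real^'r) \<Rightarrow> ereal" where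
  "G_fun f g A B b \<mu> w = Xi_fun f g A B b w + Psi_plus \<mu> (snd w)"

definition local_minimizer :: "('a::metric_space \<Rightarrow> ereal) \<Rightarrow> 'a \<Rightarrow> bool" where
  "local_minimizer h x \<longleftrightarrow> (\<exists>e>0. \<forall>x'\<in>ball x e. h x \<le> h x')"

definition stationary_D :: "(real^'n \<Rightarrow> ereal) \<Rightarrow> (real^'m \<Rightarrow> ereal) \<Rightarrow> real^'n^'m \<Rightarrow> real^'n^'r
     \<Rightarrow> real^'r \<Rightarrow> real^'r \<Rightarrow> (real^'m) \<times> (real^'r) \<Rightarrow> bool" where
  "stationary_D f g A B b \<mu> w = (case w of (y, z) \<Rightarrow>
     (\<exists>x v u. x \<in> limiting_subdiff (conj_fun f) (- (transpose A *v y) - (transpose B *v z))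
        \<and> v \<in> limiting_subdiff (conj_fun g) y
        \<and> u \<in> limiting_subdiff (Psi_plus \<mu>) z
        \<and> A *v x = v \<and> B *v x = b + u))"

definition slater_D :: "(real^'n \<Rightarrow> ereal) \<Rightarrow> (real^'m \<Rightarrow> ereal) \<Rightarrow> real^'n^'m \<Rightarrow> real^'n^'r
     \<Rightarrow> real^'r \<Rightarrow> bool" where
  "slater_D f g A B zs = (\<exists>y z.
      - (transpose A *v y) - (transpose B *v z) \<in>
          (if polyhedral_fun (conj_fun f) then edom (conj_fun f) else rel_interior (edom (conj_fun f)))
    \<and> y \<in> (if polyhedral_fun (conj_fun g) then edom (conj_fun g) else rel_interior (edom (conj_fun g)))
    \<and> (\<forall>i. zs $ i = 0 \<longrightarrow> z $ i = 0)
    \<and> (\<forall>i. zs $ i \<noteq> 0 \<longrightarrow> 0 \<le> z $ i))"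

end

theory Submission
  imports Defs
begin

text \<open>
  Near a point \<open>z\<close> of the orthant the penalty jumps by \<open>\<mu>\<^sub>i\<close> whenever a zero coordinate becomes
  positive, so it dominates every linear term supported on the zero coordinates of \<open>z\<close>. Adding this
  to the subgradient inequalities of the two conjugates gives (i).

  Conversely the penalty is locally constant on the subspace of vectors supported in \<open>T\<^sub>*\<close>, so by
  convexity a local minimizer of \<open>G\<close> minimizes \<open>\<Xi>\<close> over that subspace. In epigraph form this says that
  an affine function is nonnegative on the part of \<open>epi f\<^sup>* \<times> epi g\<^sup>* \<times> \<real>\<^sup>r\<close> lying in the kernel of a
  linear map, and a Lagrange multiplier for the linear map yields the three subgradients at once.
  The multiplier exists because finitely many affine constraints need only be feasible at a relative
  interior point of the remaining convex set; constraints describing a polyhedral epigraph are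
  therefore exempt from the relative interior condition.
\<close>

section \<open>Lagrange multipliers for affine constraints\<close>

text \<open>The parameter t ranges over all reals and not only over [0,1], so the identity also
  covers points obtained by prolonging a segment beyond one of its ends.\<close>

definition affine_fun :: "('a::real_vector \<Rightarrow> real) \<Rightarrow> bool" where
  "affine_fun h \<longleftrightarrow> (\<forall>x y t. h ((1 - t) *\<^sub>R x + t *\<^sub>R y) = (1 - t) * h x + t * h y)"

lemma affine_funD: "affine_fun h \<Longrightarrow> h ((1 - t) *\<^sub>R x + t *\<^sub>R y) = (1 - t) * h x + t * h y"
  by (simp add: affine_fun_def)

lemma affine_fun_add: "affine_fun h \<Longrightarrow> affine_fun k \<Longrightarrow> affine_fun (\<lambda>x. h x + k x)"
  by (simp add: affine_fun_def distrib_left)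

lemma affine_fun_cmult: "affine_fun h \<Longrightarrow> affine_fun (\<lambda>x. c * h x)"
  by (simp add: affine_fun_def distrib_left mult.left_commute)

lemma affine_fun_const: "affine_fun (\<lambda>x. c)"
  by (simp add: affine_fun_def algebra_simps)

lemma affine_fun_sum:
  "finite I \<Longrightarrow> (\<And>i. i \<in> I \<Longrightarrow> affine_fun (h i)) \<Longrightarrow> affine_fun (\<lambda>x. \<Sum>i\<in>I. h i x)"
  by (induction I rule: finite_induct) (auto simp: affine_fun_const intro!: affine_fun_add)

lemma affine_fun_linear_compose:
  "linear K \<Longrightarrow> affine_fun h \<Longrightarrow> affine_fun (\<lambda>x. h (K x))"
  by (simp add: affine_fun_def linear_add linear_scale)

lemma affine_fun_inner: "affine_fun (\<lambda>x. inner e x)"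
  by (simp add: affine_fun_def inner_add_right)

lemma convexD_segment:
  "convex C \<Longrightarrow> x \<in> C \<Longrightarrow> y \<in> C \<Longrightarrow> 0 \<le> t \<Longrightarrow> t \<le> 1 \<Longrightarrow> (1 - t) *\<^sub>R x + t *\<^sub>R y \<in> C"
  for t :: real
  by (rule convexD) auto

lemma convex_affine_sublevel: "convex C \<Longrightarrow> affine_fun a \<Longrightarrow> convex {x \<in> C. a x \<le> 0}"
  unfolding convex_alt
  by (auto simp: affine_funD intro!: add_nonpos_nonpos mult_nonneg_nonpos)

lemma convex_affine_level: "convex C \<Longrightarrow> affine_fun a \<Longrightarrow> convex {x \<in> C. a x = 0}"
  unfolding convex_alt by (auto simp: affine_funD)

text \<open>A segment from {a < 0} to {a > 0} crosses {a = 0}, where l is nonnegative. Hence every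
  lower bound that a point with a > 0 imposes on \<nu> lies below every upper bound from a point
  with a < 0. The infimum of the upper bounds is the largest admissible \<nu>, and it is nonnegative
  as soon as l is nonnegative on {a \<le> 0}.\<close>

lemma one_constraint_multiplier:
  fixes l a :: "'a::real_vector \<Rightarrow> real"
  assumes C: "convex C" and l: "affine_fun l" and a: "affine_fun a"
    and x1: "x1 \<in> C" "a x1 < 0" and x2: "x2 \<in> C" "0 < a x2"
    and nonneg: "\<And>x. x \<in> C \<Longrightarrow> a x = 0 \<Longrightarrow> 0 \<le> l x"
  shows "\<exists>\<nu>. (\<forall>x\<in>C. 0 \<le> l x + \<nu> * a x) \<and> ((\<forall>x\<in>C. a x \<le> 0 \<longrightarrow> 0 \<le> l x) \<longrightarrow> 0 \<le> \<nu>)"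
proof -
  define R where "R = (\<lambda>x. l x / (- a x)) ` {x \<in> C. a x < 0}"
  have cross: "- l y / a y \<le> l x / (- a x)"
    if x: "x \<in> C" "a x < 0" and y: "y \<in> C" "0 < a y" for x y
  proof -
    \<comment> \<open>The parameter at which \<open>a\<close> vanishes on the segment from x to
      y.\<close>
    define t where "t = - a x / (a y - a x)"
    have t: "0 \<le> t" "t \<le> 1" "1 - t = a y / (a y - a x)"
      using x y by (auto simp: t_def field_simps)
    have z: "(1 - t) *\<^sub>R x + t *\<^sub>R y \<in> C" using C x y t by (intro convexD_segment)
    have "a ((1 - t) *\<^sub>R x + t *\<^sub>R y) = 0"
      unfolding affine_funD[OF a] unfolding t(3) by (simp add: t_def)
    from nonneg[OF z this] have "0 \<le> a y / (a y - a x) * l x + t * l y"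
      unfolding affine_funD[OF l] unfolding t(3) .
    then have "0 \<le> (a y * l x - a x * l y) / (a y - a x)"
      by (simp add: t_def diff_divide_distrib)
    then have "0 \<le> a y * l x - a x * l y" using x y by (simp add: zero_le_divide_iff)
    then show ?thesis using x y by (simp add: field_simps)
  qed
  have ne: "R \<noteq> {}" using x1 by (auto simp: R_def)
  have bdd: "bdd_below R" unfolding R_def by (rule bdd_belowI[of _ "- l x2 / a x2"]) (use cross x2 in auto)
  have "0 \<le> l x + Inf R * a x" if x: "x \<in> C" for x
  proof (cases "a x" "0::real" rule: linorder_cases)
    case less
    then have "Inf R \<le> l x / (- a x)" using x by (intro cInf_lower bdd) (auto simp: R_def)
    then show ?thesis using less by (simp add: field_simps)
  next
    case equal then show ?thesis using nonneg x by simp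
  next
    case greater
    then have "- l x / a x \<le> Inf R" using x ne by (intro cInf_greatest) (auto simp: R_def dest: cross)
    then show ?thesis using greater by (simp add: field_simps)
  qed
  moreover have "0 \<le> Inf R" if "\<forall>x\<in>C. a x \<le> 0 \<longrightarrow> 0 \<le> l x"
    using that ne by (intro cInf_greatest) (auto simp: R_def intro!: divide_nonneg_neg divide_nonpos_neg)
  ultimately show ?thesis by blast
qed

text \<open>Segments of C that end in a relative interior point can be prolonged past it. The whole
  range of factors e is kept because some applications need a prolongation that is also
  short.\<close>

lemma rel_interior_reflect:
  fixes C :: "'a::euclidean_space set"
  assumes "convex C" "x0 \<in> rel_interior C" "x \<in> C"
  obtains m where "1 < m" "\<And>e. 1 < e \<Longrightarrow> e \<le> m \<Longrightarrow> (1 - e) *\<^sub>R x + e *\<^sub>R x0 \<in> C"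
  using convex_rel_interior_if[OF assms(1,2)] assms(3) rel_interior_subset hull_inc
  by (metis (no_types, lifting))

text \<open>If h were positive at x, prolonging the segment from x past x0 would make h negative
  inside C.\<close>

lemma affine_fun_zero_if_min_rel_interior:
  fixes C :: "'a::euclidean_space set"
  assumes "convex C" "x0 \<in> rel_interior C" "affine_fun h"
    and "\<And>x. x \<in> C \<Longrightarrow> 0 \<le> h x" "h x0 \<le> 0" "x \<in> C"
  shows "h x = 0"
proof -
  obtain m where m: "1 < m" "(1 - m) *\<^sub>R x + m *\<^sub>R x0 \<in> C"
    using rel_interior_reflect[OF assms(1,2,6)] by (metis order_refl)
  have "0 \<le> (1 - m) * h x + m * h x0"
    using assms(4)[OF m(2)] by (simp add: affine_funD[OF assms(3)])
  moreover have "m * h x0 \<le> 0" using m assms(5) by (simp add: mult_nonneg_nonpos)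
  ultimately have "0 \<le> (1 - m) * h x" by linarith
  then have "h x \<le> 0" using m by (simp add: zero_le_mult_iff)
  then show ?thesis using assms(4,6) by (meson order_antisym)
qed

text \<open>An affine function that vanishes at x and x0 vanishes on the line through them, so the
  prolonged segment stays in the level set.\<close>

lemma rel_interior_affine_level:
  fixes C :: "'a::euclidean_space set"
  assumes C: "convex C" and x0: "x0 \<in> rel_interior C" and a: "affine_fun a" "a x0 = 0"
  shows "x0 \<in> rel_interior {x \<in> C. a x = 0}"
proof -
  have x0C: "x0 \<in> C" using x0 rel_interior_subset by blast
  have "\<exists>e>1. (1 - e) *\<^sub>R x + e *\<^sub>R x0 \<in> {x \<in> C. a x = 0}" if "x \<in> {x \<in> C. a x = 0}" for x
  proof -
    from that have x: "x \<in> C" "a x = 0" by auto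
    obtain m where "1 < m" "(1 - m) *\<^sub>R x + m *\<^sub>R x0 \<in> C"
      using rel_interior_reflect[OF C x0 x(1)] by (metis order_refl)
    then show ?thesis using x a by (auto simp: affine_funD)
  qed
  then show ?thesis
    using convex_rel_interior_iff[OF convex_affine_level[OF C a(1)]] x0C a by blast
qed

text \<open>The strict inequality at x0 leaves room to go slightly past x0 without leaving the
  sublevel set.\<close>

lemma rel_interior_affine_sublevel:
  fixes C :: "'a::euclidean_space set"
  assumes C: "convex C" and x0: "x0 \<in> rel_interior C" and a: "affine_fun a" "a x0 < 0"
  shows "x0 \<in> rel_interior {x \<in> C. a x \<le> 0}"
proof -
  have x0C: "x0 \<in> C" using x0 rel_interior_subset by blast
  have "\<exists>e>1. (1 - e) *\<^sub>R x + e *\<^sub>R x0 \<in> {x \<in> C. a x \<le> 0}" if "x \<in> {x \<in> C. a x \<le> 0}" for x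
  proof -
    from that have x: "x \<in> C" "a x \<le> 0" by auto
    obtain m where m: "1 < m" "\<And>e. 1 < e \<Longrightarrow> e \<le> m \<Longrightarrow> (1 - e) *\<^sub>R x + e *\<^sub>R x0 \<in> C"
      using rel_interior_reflect[OF C x0 x(1)] by metis
    \<comment> \<open>A bound on e - 1 that keeps \<open>a\<close> nonpositive at the prolonged
      point. The summand 1 keeps the denominator positive when \<open>a x\<close> is zero.\<close>
    define s where "s = - a x0 / (1 - a x)"
    have s: "0 < s" unfolding s_def by (rule divide_pos_pos) (use a x in auto)
    define e where "e = min m (1 + s)"
    have e: "1 < e" "e \<le> m" "e \<le> 1 + s" using m s by (auto simp: e_def)
    have "(e - 1) * (- a x) \<le> s * (1 - a x)" using e x s by (intro mult_mono) auto
    also have "\<dots> = - a x0" using x by (simp add: s_def)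
    also have "\<dots> \<le> e * (- a x0)" using e a by simp
    finally have "a ((1 - e) *\<^sub>R x + e *\<^sub>R x0) \<le> 0"
      unfolding affine_funD[OF a(1)] by (simp add: algebra_simps)
    then show ?thesis using e m by blast
  qed
  then show ?thesis
    using convex_rel_interior_iff[OF convex_affine_sublevel[OF C a(1)]] x0C a
    by (metis (no_types, lifting) empty_iff mem_Collect_eq order_less_imp_le)
qed

text \<open>Induction on the constraints, with C, l and x0 varying: one constraint \<open>a\<close>
  is absorbed into C, the others are treated by the induction hypothesis, and \<open>a\<close> is
  then released. If \<open>a\<close> can be strict on the feasible set, C shrinks to {a \<le> 0},
  otherwise to {a = 0}; in both cases a feasible relative interior point survives.\<close>

theorem convex_affine_multipliers:
  fixes C :: "'a::euclidean_space set" and l :: "'a \<Rightarrow> real"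
  assumes "finite I" "convex C" "affine_fun l" "x0 \<in> rel_interior C"
    and "\<And>h. h \<in> I \<Longrightarrow> affine_fun h" "\<And>h. h \<in> I \<Longrightarrow> h x0 \<le> 0"
    and "\<And>x. x \<in> C \<Longrightarrow> (\<And>h. h \<in> I \<Longrightarrow> h x \<le> 0) \<Longrightarrow> 0 \<le> l x"
  shows "\<exists>\<eta>. (\<forall>h\<in>I. 0 \<le> \<eta> h) \<and> (\<forall>x\<in>C. 0 \<le> l x + (\<Sum>h\<in>I. \<eta> h * h x))"
  using assms
proof (induction I arbitrary: C l x0 rule: finite_induct)
  case empty
  then show ?case by auto
next
  case (insert a I)
  note C = insert.prems(1) and l = insert.prems(2) and x0 = insert.prems(3)
  have a: "affine_fun a" and I: "\<And>h. h \<in> I \<Longrightarrow> affine_fun h" using insert.prems by auto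
  have a0: "a x0 \<le> 0" and I0: "\<And>h. h \<in> I \<Longrightarrow> h x0 \<le> 0" using insert.prems by auto
  have nonneg: "0 \<le> l x" if "x \<in> C" "a x \<le> 0" "\<And>h. h \<in> I \<Longrightarrow> h x \<le> 0" for x
    using insert.prems(6)[of x] that by blast
  have IH: "\<exists>\<eta>. (\<forall>h\<in>I. 0 \<le> \<eta> h) \<and> (\<forall>x\<in>D. 0 \<le> k x + (\<Sum>h\<in>I. \<eta> h * h x))"
    if "convex D" "affine_fun k" "y \<in> rel_interior D" "\<forall>h\<in>I. h y \<le> 0"
      "\<forall>x\<in>D. (\<forall>h\<in>I. h x \<le> 0) \<longrightarrow> 0 \<le> k x" for D k y
    by (rule insert.IH[of D k y]) (use that I in auto)
  have aff: "affine_fun (\<lambda>x. l x + (\<Sum>h\<in>I. \<eta> h * h x))" for \<eta>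
    using insert.hyps I l by (intro affine_fun_add affine_fun_sum affine_fun_cmult)
  have upd: "(\<Sum>h\<in>insert a I. (if h = a then c else \<eta> h) * h x) = c * a x + (\<Sum>h\<in>I. \<eta> h * h x)"
    for c \<eta> x
  proof -
    have "(\<Sum>h\<in>I. (if h = a then c else \<eta> h) * h x) = (\<Sum>h\<in>I. \<eta> h * h x)"
      using insert.hyps by (intro sum.cong) auto
    then show ?thesis using insert.hyps by simp
  qed
  have conclude: ?case
    if "\<forall>h\<in>I. 0 \<le> \<eta> h" "0 \<le> c" "\<forall>x\<in>C. 0 \<le> l x + (\<Sum>h\<in>I. \<eta> h * h x) + c * a x" for c \<eta>
    using that insert.hyps
    by (intro exI[of _ "\<lambda>h. if h = a then c else \<eta> h"]) (auto simp only: upd, auto simp: algebra_simps)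
  show ?case
  proof (cases "\<exists>x1\<in>C. a x1 < 0 \<and> (\<forall>h\<in>I. h x1 \<le> 0)")
    case True
    then obtain x1 where x1: "x1 \<in> C" "a x1 < 0" "\<And>h. h \<in> I \<Longrightarrow> h x1 \<le> 0" by blast
    \<comment> \<open>The midpoint is relatively interior because of x0, strict for \<open>a\<close>
      because of x1, and feasible for I because both ends are.\<close>
    define y where "y = (1 - 1/2) *\<^sub>R x0 + (1/2::real) *\<^sub>R x1"
    have "x1 - (1/2::real) *\<^sub>R (x1 - x0) = ((1/2) *\<^sub>R x1 + (1/2) *\<^sub>R x1) - (1/2) *\<^sub>R (x1 - x0)"
      by (simp flip: scaleR_add_left)
    also have "\<dots> = y" by (simp add: y_def scaleR_diff_right)
    finally have y: "y \<in> rel_interior C"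
      using rel_interior_convex_shrink[OF C x0 x1(1), of "1/2"] by simp
    have yC: "y \<in> C" using y rel_interior_subset by blast
    have ay: "a y < 0" using a0 x1 unfolding y_def affine_funD[OF a] by simp
    have hy: "h y \<le> 0" if "h \<in> I" for h
      using I0 x1 that unfolding y_def affine_funD[OF I[OF that]] by (simp add: add_nonpos_nonpos)
    from IH[OF convex_affine_sublevel[OF C a] l rel_interior_affine_sublevel[OF C y a ay]] hy nonneg
    obtain \<eta> where lam: "\<forall>h\<in>I. 0 \<le> \<eta> h"
      "\<forall>x\<in>{x \<in> C. a x \<le> 0}. 0 \<le> l x + (\<Sum>h\<in>I. \<eta> h * h x)"
      by auto
    show ?thesis
    proof (cases "\<exists>x2\<in>C. 0 < a x2")
      case True
      then obtain x2 where x2: "x2 \<in> C" "0 < a x2" by blast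
      obtain c where "\<forall>x\<in>C. 0 \<le> l x + (\<Sum>h\<in>I. \<eta> h * h x) + c * a x" "0 \<le> c"
        using one_constraint_multiplier[OF C aff[of \<eta>] a yC ay x2] lam by auto
      then show ?thesis using conclude lam(1) by blast
    next
      case False
      then show ?thesis using lam conclude[of \<eta> 0] by (auto simp: not_less)
    qed
  next
    case False
    \<comment> \<open>Then \<open>a\<close> vanishes on the feasible set and \<open>- a\<close> agrees on \<open>C\<close> with a conic combination of \<open>I\<close>,
      so a multiplier of \<open>a\<close> of either sign is admissible.\<close>
    then have "0 \<le> a x" if "x \<in> C" "\<And>h. h \<in> I \<Longrightarrow> h x \<le> 0" for x
      using that by (meson not_less)
    \<comment> \<open>Here the induction hypothesis is used with \<open>a\<close> itself as the
      objective.\<close>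
    with IH[OF C a x0] I0 obtain \<kappa> where kap: "\<forall>h\<in>I. 0 \<le> \<kappa> h" "\<forall>x\<in>C. 0 \<le> a x + (\<Sum>h\<in>I. \<kappa> h * h x)" by auto
    have affk: "affine_fun (\<lambda>x. a x + (\<Sum>h\<in>I. \<kappa> h * h x))"
      using insert.hyps I a by (intro affine_fun_add affine_fun_sum affine_fun_cmult)
    have "(\<Sum>h\<in>I. \<kappa> h * h x0) \<le> 0"
      using kap I0 by (intro sum_nonpos mult_nonneg_nonpos) auto
    moreover have x0C: "x0 \<in> C" using x0 rel_interior_subset by blast
    ultimately have a00: "a x0 = 0" using kap(2) a0 by force
    have zero: "a x + (\<Sum>h\<in>I. \<kappa> h * h x) = 0" if "x \<in> C" for x
      by (rule affine_fun_zero_if_min_rel_interior[OF C x0 affk])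
        (use kap a0 \<open>(\<Sum>h\<in>I. \<kappa> h * h x0) \<le> 0\<close> that in auto)
    \<comment> \<open>On the level set x0 is still relatively interior, and l is nonnegative
      wherever the constraints in I hold.\<close>
    from IH[OF convex_affine_level[OF C a] l rel_interior_affine_level[OF C x0 a a00]] I0 nonneg
    obtain \<eta> where lam: "\<forall>h\<in>I. 0 \<le> \<eta> h"
      "\<forall>x\<in>{x \<in> C. a x = 0}. 0 \<le> l x + (\<Sum>h\<in>I. \<eta> h * h x)"
      by auto
    obtain \<nu> where nu: "\<forall>x\<in>C. 0 \<le> l x + (\<Sum>h\<in>I. \<eta> h * h x) + \<nu> * a x"
    proof (cases "\<exists>x\<in>C. a x \<noteq> 0")
      case False
      then show ?thesis using lam that[of 0] by auto
    next
      case True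
      then obtain x where x: "x \<in> C" "a x \<noteq> 0" by blast
      \<comment> \<open>Vanishing at a relative interior point but not on all of C, \<open>a\<close>
        takes both signs on C.\<close>
      have "\<exists>x1\<in>C. a x1 < 0"
        using affine_fun_zero_if_min_rel_interior[OF C x0 a _ _ x(1)] a00 x(2) by force
      moreover have "\<exists>x2\<in>C. 0 < a x2"
        using affine_fun_zero_if_min_rel_interior[OF C x0 affine_fun_cmult[OF a, of "-1"] _ _ x(1)] a00 x(2)
        by force
      ultimately obtain x1 x2 where x12: "x1 \<in> C" "a x1 < 0" "x2 \<in> C" "0 < a x2" by blast
      have "\<exists>\<nu>. \<forall>x\<in>C. 0 \<le> l x + (\<Sum>h\<in>I. \<eta> h * h x) + \<nu> * a x"
        using one_constraint_multiplier[OF C aff[of \<eta>] a x12] lam(2) by blast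
      then show ?thesis using that by blast
    qed
    show ?thesis
    proof (cases "0 \<le> \<nu>")
      case True
      then show ?thesis using conclude lam nu by blast
    next
      case False
      \<comment> \<open>On C the term \<nu> a equals -\<nu> times the \<kappa>-combination of I.
        Since \<nu> < 0, moving it there only increases the multipliers of I, and \<open>a\<close>
        receives multiplier 0.\<close>
      define \<eta>' where "\<eta>' h = \<eta> h - \<nu> * \<kappa> h" for h
      have "(\<Sum>h\<in>I. \<eta>' h * h x) = (\<Sum>h\<in>I. \<eta> h * h x) + \<nu> * a x" if "x \<in> C" for x
      proof -
        have "(\<Sum>h\<in>I. \<eta>' h * h x) = (\<Sum>h\<in>I. \<eta> h * h x) - \<nu> * (\<Sum>h\<in>I. \<kappa> h * h x)"
          by (simp add: \<eta>'_def algebra_simps sum_subtractf sum_distrib_left)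
        moreover have "a x = - (\<Sum>h\<in>I. \<kappa> h * h x)" using zero[OF that] by linarith
        ultimately show ?thesis by simp
      qed
      moreover have "\<forall>h\<in>I. 0 \<le> \<eta>' h"
        using lam kap False by (auto simp: \<eta>'_def intro!: order_trans[OF mult_nonpos_nonneg])
      ultimately show ?thesis using conclude[of \<eta>' 0] nu by (simp add: add.assoc)
    qed
  qed
qed

section \<open>Epigraphs and qualified intersections\<close>

text \<open>E is split into a part C, to which x0 must be relatively interior, and finitely many
  affine inequalities, which x0 need only satisfy. This format covers both forms of the Slater
  condition and is stable under products.\<close>

definition qualified_at :: "'a::euclidean_space set \<Rightarrow> 'a \<Rightarrow> bool" where
  "qualified_at E x0 \<longleftrightarrow> (\<exists>C I. convex C \<and> finite I \<and> (\<forall>h\<in>I. affine_fun h) \<and>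
     E = {x \<in> C. \<forall>h\<in>I. h x \<le> 0} \<and> x0 \<in> rel_interior C \<and> x0 \<in> E)"

lemma qualified_at_rel_interior: "convex E \<Longrightarrow> x0 \<in> rel_interior E \<Longrightarrow> qualified_at E x0"
  unfolding qualified_at_def
  using rel_interior_subset by (intro exI[of _ E] exI[of _ "{}"]) auto

text \<open>With C the whole space, all half-spaces that define the polyhedron become affine
  constraints.\<close>

lemma qualified_at_polyhedron:
  assumes "polyhedron E" "x0 \<in> E"
  shows "qualified_at E x0"
proof -
  from assms(1) obtain H where H: "finite H" "E = \<Inter>H" "\<forall>S\<in>H. \<exists>a b. a \<noteq> 0 \<and> S = {x. inner a x \<le> b}"
    unfolding polyhedron_def by blast
  then obtain a b where ab: "\<And>S. S \<in> H \<Longrightarrow> S = {x. inner (a S) x \<le> b S}" by metis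
  have aff: "affine_fun (\<lambda>x. inner (a S) x - b S)" for S
    using affine_fun_add[OF affine_fun_inner affine_fun_const[of "- b S"]] by simp
  have "E = {x. \<forall>S\<in>H. inner (a S) x - b S \<le> 0}"
    using H(2) ab by auto
  then show ?thesis unfolding qualified_at_def
    using H(1) aff assms(2)
    by (intro exI[of _ UNIV] exI[of _ "(\<lambda>S x. inner (a S) x - b S) ` H"]) auto
qed

text \<open>Relative interiors multiply, and the constraints of each factor are composed with the
  projections.\<close>

lemma qualified_at_Times:
  assumes "qualified_at E x0" "qualified_at F y0"
  shows "qualified_at (E \<times> F) (x0, y0)"
proof -
  obtain C I where C: "convex C" "finite I" "\<forall>h\<in>I. affine_fun h"
    "E = {x \<in> C. \<forall>h\<in>I. h x \<le> 0}" "x0 \<in> rel_interior C" "x0 \<in> E"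
    using assms(1) unfolding qualified_at_def by blast
  obtain D J where D: "convex D" "finite J" "\<forall>h\<in>J. affine_fun h"
    "F = {x \<in> D. \<forall>h\<in>J. h x \<le> 0}" "y0 \<in> rel_interior D" "y0 \<in> F"
    using assms(2) unfolding qualified_at_def by blast
  have "\<forall>h\<in>(\<lambda>h w. h (fst w)) ` I \<union> (\<lambda>h w. h (snd w)) ` J. affine_fun h"
    using C D by (auto intro: affine_fun_linear_compose[OF linear_fst] affine_fun_linear_compose[OF linear_snd])
  moreover have "E \<times> F =
      {w \<in> C \<times> D. \<forall>h\<in>(\<lambda>h w. h (fst w)) ` I \<union> (\<lambda>h w. h (snd w)) ` J. h w \<le> 0}"
    unfolding C(4) D(4) ball_Un ball_simps by auto
  moreover have "(x0, y0) \<in> rel_interior (C \<times> D)"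
    using C D by (simp add: rel_interior_Times)
  moreover have "(x0, y0) \<in> E \<times> F" using C(6) D(6) by simp
  moreover have "finite ((\<lambda>h w. h (fst w)) ` I \<union> (\<lambda>h w. h (snd w)) ` J)"
    using C(2) D(2) by simp
  moreover have "convex (C \<times> D)" using C(1) D(1) by (rule convex_Times)
  ultimately show ?thesis unfolding qualified_at_def by (intro exI conjI)
qed

theorem qualified_linear_multiplier:
  fixes E :: "'a::euclidean_space set" and K :: "'a \<Rightarrow> 'b::euclidean_space"
  assumes E: "qualified_at E x0" and K: "linear K" "K x0 = 0" and l: "affine_fun l"
    and nonneg: "\<And>x. x \<in> E \<Longrightarrow> K x = 0 \<Longrightarrow> 0 \<le> l x"
  shows "\<exists>v. \<forall>x\<in>E. 0 \<le> l x + inner v (K x)"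
proof -
  obtain C I where C: "convex C" "finite I" "\<forall>h\<in>I. affine_fun h"
    "E = {x \<in> C. \<forall>h\<in>I. h x \<le> 0}" "x0 \<in> rel_interior C" "x0 \<in> E"
    using E unfolding qualified_at_def by blast
  define B :: "'b set" where "B = Basis \<union> uminus ` Basis"
  define J where "J = (\<lambda>e x. inner e (K x)) ` B"
  have J: "finite J" by (simp add: J_def B_def)
  have affJ: "affine_fun h" if "h \<in> J" for h
    using that affine_fun_linear_compose[OF K(1) affine_fun_inner] by (auto simp: J_def)
  have K0: "K x = 0" if "\<And>h. h \<in> J \<Longrightarrow> h x \<le> 0" for x
  proof (rule euclidean_eqI)
    fix e :: 'b assume "e \<in> Basis"
    then have "inner e (K x) \<le> 0" "inner (- e) (K x) \<le> 0"
      using that[of "\<lambda>x. inner e (K x)"] that[of "\<lambda>x. inner (- e) (K x)"]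
      unfolding J_def B_def by blast+
    then show "inner (K x) e = inner 0 e" by (simp add: inner_commute)
  qed
  have "\<exists>\<eta>. (\<forall>h\<in>I \<union> J. 0 \<le> \<eta> h) \<and> (\<forall>x\<in>C. 0 \<le> l x + (\<Sum>h\<in>I \<union> J. \<eta> h * h x))"
  proof (rule convex_affine_multipliers[OF _ C(1) l C(5)])
    show "finite (I \<union> J)" using C J by simp
    show "affine_fun h" if "h \<in> I \<union> J" for h using that C affJ by blast
    show "h x0 \<le> 0" if "h \<in> I \<union> J" for h using that C K by (auto simp: J_def)
    show "0 \<le> l x" if "x \<in> C" "\<And>h. h \<in> I \<union> J \<Longrightarrow> h x \<le> 0" for x
      using that C K0 by (intro nonneg) auto
  qed
  then obtain \<eta> where \<eta>: "\<forall>h\<in>I \<union> J. 0 \<le> \<eta> h" "\<forall>x\<in>C. 0 \<le> l x + (\<Sum>h\<in>I \<union> J. \<eta> h * h x)" by blast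
  have "\<forall>h\<in>J. \<exists>e. h = (\<lambda>x. inner e (K x))" by (auto simp: J_def)
  from bchoice[OF this] obtain e where e: "\<And>h. h \<in> J \<Longrightarrow> h = (\<lambda>x. inner (e h) (K x))" by blast
  \<comment> \<open>A function may belong to both I and J. It is counted with I, where its term is
    nonpositive on E.\<close>
  define v where "v = (\<Sum>h\<in>J - I. \<eta> h *\<^sub>R e h)"
  have "0 \<le> l x + inner v (K x)" if x: "x \<in> E" for x
  proof -
    have "(\<Sum>h\<in>I \<union> J. \<eta> h * h x) = (\<Sum>h\<in>I. \<eta> h * h x) + (\<Sum>h\<in>J - I. \<eta> h * h x)"
      using sum.union_disjoint[of I "J - I" "\<lambda>h. \<eta> h * h x"] C J by simp
    also have "(\<Sum>h\<in>J - I. \<eta> h * h x) = (\<Sum>h\<in>J - I. \<eta> h * inner (e h) (K x))"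
      by (rule sum.cong) (auto dest: fun_cong[OF e])
    also have "\<dots> = inner v (K x)" by (simp add: v_def inner_sum_left)
    finally have "(\<Sum>h\<in>I \<union> J. \<eta> h * h x) = (\<Sum>h\<in>I. \<eta> h * h x) + inner v (K x)" .
    moreover have "(\<Sum>h\<in>I. \<eta> h * h x) \<le> 0"
      using x C \<eta> by (intro sum_nonpos mult_nonneg_nonpos) auto
    moreover have "0 \<le> l x + (\<Sum>h\<in>I \<union> J. \<eta> h * h x)" using \<eta>(2) x C by blast
    ultimately show ?thesis by linarith
  qed
  then show ?thesis by blast
qed

section \<open>Epigraphs of conjugate functions\<close>

abbreviation epigraph :: "('a \<Rightarrow> ereal) \<Rightarrow> ('a \<times> real) set" where
  "epigraph h \<equiv> {(x, t::real). h x \<le> ereal t}"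

lemma conj_fun_not_MInfty: "proper_fun f \<Longrightarrow> conj_fun f u \<noteq> -\<infinity>"
proof -
  assume "proper_fun f"
  then obtain x where x: "f x \<noteq> -\<infinity>" "f x < \<infinity>" unfolding proper_fun_def by blast
  then obtain r where "f x = ereal r" by (cases "f x") auto
  then have "ereal (inner u x - r) \<le> conj_fun f u"
    unfolding conj_fun_def by (intro SUP_upper2[of x]) auto
  then show ?thesis by auto
qed

text \<open>A conjugate is a supremum of affine functions. Convexity is expressed through the
  epigraph, so that later estimates involve real upper bounds only.\<close>

lemma convex_epigraph_conj_fun:
  assumes "proper_fun f"
  shows "convex (epigraph (conj_fun f))"
proof -
  have "conj_fun f ((1 - t) *\<^sub>R x + t *\<^sub>R y) \<le> ereal ((1 - t) * \<alpha> + t * \<beta>)"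
    if "conj_fun f x \<le> ereal \<alpha>" "conj_fun f y \<le> ereal \<beta>" "0 \<le> t" "t \<le> 1" for x y \<alpha> \<beta> t
    unfolding conj_fun_def
  proof (rule SUP_least)
    fix w
    show "ereal (inner ((1 - t) *\<^sub>R x + t *\<^sub>R y) w) - f w \<le> ereal ((1 - t) * \<alpha> + t * \<beta>)"
    proof (cases "f w")
      case (real r)
      have "ereal (inner x w) - f w \<le> conj_fun f x" "ereal (inner y w) - f w \<le> conj_fun f y"
        unfolding conj_fun_def by (rule SUP_upper; simp)+
      then have "ereal (inner x w) - f w \<le> ereal \<alpha>" "ereal (inner y w) - f w \<le> ereal \<beta>"
        using that order_trans by blast+
      then have "inner x w - r \<le> \<alpha>" "inner y w - r \<le> \<beta>" by (simp_all add: real)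
      then have "(1 - t) * (inner x w - r) + t * (inner y w - r) \<le> (1 - t) * \<alpha> + t * \<beta>"
        using that by (intro add_mono mult_left_mono) auto
      then show ?thesis by (simp add: real inner_add_left algebra_simps)
    qed (use assms in \<open>auto simp: proper_fun_def\<close>)
  qed
  then show ?thesis unfolding convex_alt by auto
qed

lemma epigraph_convexD:
  assumes "convex (epigraph h)" "h x \<le> ereal \<alpha>" "h y \<le> ereal \<beta>" "0 \<le> t" "t \<le> 1"
  shows "h ((1 - t) *\<^sub>R x + t *\<^sub>R y) \<le> ereal ((1 - t) * \<alpha> + t * \<beta>)"
  using convexD_segment[OF assms(1), of "(x, \<alpha>)" "(y, \<beta>)" t] assms by auto

lemma edom_eq_fst_epigraph: "edom h = fst ` epigraph h"
proof -
  have "\<exists>t. h x \<le> ereal t" if "h x < \<infinity>" for x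
    using that by (cases "h x") auto
  then show ?thesis by (force simp: edom_def)
qed

text \<open>A segment of the epigraph ending at (x0, t0) must be prolonged. Its projection can be
  prolonged in the domain; near x0 convexity keeps h close to or below r, and the gap between r and
  t0 absorbs the error.\<close>

lemma rel_interior_epigraph:
  fixes h :: "'a::euclidean_space \<Rightarrow> ereal"
  assumes cvx: "convex (epigraph h)" and x0: "x0 \<in> rel_interior (edom h)"
    and t0: "h x0 \<le> ereal r" "r < t0"
  shows "(x0, t0) \<in> rel_interior (epigraph h)"
proof -
  have dom: "convex (edom h)" unfolding edom_eq_fst_epigraph
    by (rule convex_linear_image[OF linear_fst cvx])
  have "\<exists>e>1. (1 - e) *\<^sub>R w + e *\<^sub>R (x0, t0) \<in> epigraph h" if "w \<in> epigraph h" for w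
  proof -
    from that obtain x t where w: "w = (x, t)" "h x \<le> ereal t" by auto
    have "x \<in> edom h" using w by (auto simp: edom_def)
    then obtain m where m: "1 < m" "(1 - m) *\<^sub>R x + m *\<^sub>R x0 \<in> edom h"
      using rel_interior_reflect[OF dom x0] by (metis order_refl)
    then obtain s where s: "h ((1 - m) *\<^sub>R x + m *\<^sub>R x0) \<le> ereal s"
      unfolding edom_eq_fst_epigraph by auto
    \<comment> \<open>M bounds the rate at which the convexity estimate of h gains on the height of
      the prolonged segment; the step c is chosen so that c M does not exceed the gap.\<close>
    define M where "M = \<bar>s - r\<bar> + \<bar>m - 1\<bar> * \<bar>t0 - t\<bar> + 1"
    define c where "c = min 1 ((t0 - r) / M)"
    have M: "1 \<le> M" by (simp add: M_def)
    have c: "0 < c" "c \<le> 1" "c * M \<le> t0 - r"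
      using M t0 by (auto simp: c_def min_def field_simps)
    \<comment> \<open>The factor that reaches the point a fraction c of the way from x0 to the
      prolonged point of factor m.\<close>
    define e where "e = 1 + c * (m - 1)"
    have e: "1 < e" using c m by (simp add: e_def)
    have "h ((1 - c) *\<^sub>R x0 + c *\<^sub>R ((1 - m) *\<^sub>R x + m *\<^sub>R x0)) \<le> ereal ((1 - c) * r + c * s)"
      using c by (intro epigraph_convexD[OF cvx t0(1) s]) auto
    also have "(1 - c) *\<^sub>R x0 + c *\<^sub>R ((1 - m) *\<^sub>R x + m *\<^sub>R x0) = (1 - e) *\<^sub>R x + e *\<^sub>R x0"
      by (simp add: e_def algebra_simps)
    finally have 1: "h ((1 - e) *\<^sub>R x + e *\<^sub>R x0) \<le> ereal ((1 - c) * r + c * s)" .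
    have "- ((m - 1) * (t0 - t)) \<le> \<bar>m - 1\<bar> * \<bar>t0 - t\<bar>"
      unfolding abs_mult[symmetric] by linarith
    then have "(s - r) - (m - 1) * (t0 - t) \<le> M" unfolding M_def by linarith
    then have "c * ((s - r) - (m - 1) * (t0 - t)) \<le> t0 - r"
      using c by (meson mult_left_mono order_less_imp_le order_trans)
    then have "(1 - c) * r + c * s \<le> (1 - e) * t + e * t0"
      by (simp add: e_def algebra_simps)
    with 1 have "h ((1 - e) *\<^sub>R x + e *\<^sub>R x0) \<le> ereal ((1 - e) * t + e * t0)"
      by (meson ereal_less_eq(3) order_trans)
    then show ?thesis using e w by auto
  qed
  moreover have "epigraph h \<noteq> {}" using t0 by auto
  ultimately show ?thesis using convex_rel_interior_iff[OF cvx] by blast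
qed

lemma qualified_at_epigraph:
  fixes h :: "'a::euclidean_space \<Rightarrow> ereal"
  assumes "convex (epigraph h)"
    and "x0 \<in> (if polyhedral_fun h then edom h else rel_interior (edom h))"
  shows "\<exists>t0. qualified_at (epigraph h) (x0, t0)"
proof -
  have "x0 \<in> edom h" using assms(2) rel_interior_subset by (auto split: if_splits)
  then obtain r where r: "h x0 \<le> ereal r" unfolding edom_eq_fst_epigraph by auto
  show ?thesis
  proof (cases "polyhedral_fun h")
    case True
    then show ?thesis using r
      by (intro exI[of _ r] qualified_at_polyhedron) (auto simp: polyhedral_fun_def)
  next
    case False
    \<comment> \<open>The height r + 1 lies strictly above the graph, as relative interiority
      requires.\<close>
    then show ?thesis using assms rel_interior_epigraph[OF assms(1) _ r, of "r + 1"]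
      by (intro exI[of _ "r + 1"] qualified_at_rel_interior) auto
  qed
qed

section \<open>Subgradients and growth of the penalty\<close>

lemma frechet_subdiffD:
  assumes "v \<in> frechet_subdiff h x"
  shows "\<bar>h x\<bar> \<noteq> \<infinity>"
    and "0 < e \<Longrightarrow> \<exists>d>0. \<forall>x'. norm (x' - x) < d \<longrightarrow>
           ereal (real_of_ereal (h x) + inner v (x' - x) - e * norm (x' - x)) \<le> h x'"
  using assms by (simp_all add: frechet_subdiff_def)

text \<open>On a short step from x towards x' the Frechet inequality bounds h below and the chord
  bounds it above. Dividing by the step length and letting e tend to 0 gives the global
  inequality.\<close>

lemma frechet_subdiff_subgradient:
  assumes cvx: "convex (epigraph h)" and v: "v \<in> frechet_subdiff h x" and fin: "h x' \<noteq> -\<infinity>"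
  shows "h x + ereal (inner v (x' - x)) \<le> h x'"
proof (cases "h x'")
  case (real s)
  from v obtain r where r: "h x = ereal r" by (auto simp: frechet_subdiff_def)
  define d where "d = x' - x"
  have bound: "inner v d \<le> (s - r) + e * norm d" if "0 < e" for e
  proof -
    from v that obtain \<delta> where \<delta>: "0 < \<delta>"
      "\<And>y. norm (y - x) < \<delta> \<Longrightarrow> ereal (r + inner v (y - x) - e * norm (y - x)) \<le> h y"
      unfolding frechet_subdiff_def using r by auto
    define t where "t = min 1 (\<delta> / (norm d + 1) / 2)"
    have nd: "0 < norm d + 1" using norm_ge_zero[of d] by linarith
    have t: "0 < t" "t \<le> 1" using \<delta> nd by (auto simp: t_def)
    have "t * norm d < \<delta>"
    proof -
      have "t * norm d \<le> t * (norm d + 1)" using t by simp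
      also have "\<dots> \<le> \<delta> / (norm d + 1) / 2 * (norm d + 1)" using nd by (intro mult_right_mono) (auto simp: t_def)
      also have "\<dots> = \<delta> / 2" using nd by (simp add: field_simps)
      finally show ?thesis using \<delta> by linarith
    qed
    moreover have y: "(1 - t) *\<^sub>R x + t *\<^sub>R x' - x = t *\<^sub>R d" by (simp add: d_def algebra_simps)
    ultimately have "ereal (r + inner v (t *\<^sub>R d) - e * norm (t *\<^sub>R d)) \<le> h ((1 - t) *\<^sub>R x + t *\<^sub>R x')"
      using \<delta>(2)[of "(1 - t) *\<^sub>R x + t *\<^sub>R x'"] t unfolding y by simp
    also have "\<dots> \<le> ereal ((1 - t) * r + t * s)"
      using t by (intro epigraph_convexD[OF cvx]) (auto simp: r real)
    finally have "t * inner v d \<le> t * ((s - r) + e * norm d)"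
      using t by (simp add: algebra_simps)
    then show ?thesis using t by simp
  qed
  have "inner v d \<le> s - r"
  proof (rule field_le_epsilon)
    fix e :: real assume "0 < e"
    have nd: "0 < norm d + 1" using norm_ge_zero[of d] by linarith
    have "inner v d \<le> (s - r) + e / (norm d + 1) * norm d" using \<open>0 < e\<close> nd by (intro bound) simp
    also have "e / (norm d + 1) * norm d \<le> e / (norm d + 1) * (norm d + 1)"
      using \<open>0 < e\<close> nd by (intro mult_left_mono) auto
    finally show "inner v d \<le> s - r + e" using nd by simp
  qed
  then show ?thesis by (simp add: r real d_def)
qed (use fin in auto)

text \<open>The global inequalities along the approximating sequence pass to the limit. Testing the
  limit inequality at \<open>xs 0\<close>, where h is finite, shows that h is finite at x.\<close>

lemma limiting_subdiff_subgradient: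
  assumes cvx: "convex (epigraph h)" and fin: "\<And>x. h x \<noteq> -\<infinity>" and v: "v \<in> limiting_subdiff h x"
  shows "h x < \<infinity>" "h x + ereal (inner v (x' - x)) \<le> h x'"
proof -
  obtain xs vs where xs: "xs \<longlonglongrightarrow> x" "(\<lambda>k. h (xs k)) \<longlonglongrightarrow> h x"
    "\<And>k. vs k \<in> frechet_subdiff h (xs k)" "vs \<longlonglongrightarrow> v"
    using v unfolding limiting_subdiff_def by blast
  have le: "h x + ereal (inner v (y - x)) \<le> h y" for y
  proof (rule LIMSEQ_le_const2)
    show "(\<lambda>k. h (xs k) + ereal (inner (vs k) (y - xs k))) \<longlonglongrightarrow> h x + ereal (inner v (y - x))"
      using xs fin by (intro tendsto_add_ereal_general) (auto intro!: tendsto_intros)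
    show "\<exists>N. \<forall>n\<ge>N. h (xs n) + ereal (inner (vs n) (y - xs n)) \<le> h y"
      using frechet_subdiff_subgradient[OF cvx xs(3) fin] by blast
  qed
  have "h (xs 0) \<noteq> \<infinity>" using xs(3)[of 0] by (auto simp: frechet_subdiff_def)
  with le[of "xs 0"] show "h x < \<infinity>" by (cases "h x") auto
  show "h x + ereal (inner v (x' - x)) \<le> h x'" by (rule le)
qed

text \<open>Constant sequences suffice. The inequality is local so that the lemma also applies to
  the nonconvex penalty.\<close>

lemma limiting_subdiff_if_local_subgradient:
  assumes "\<bar>h x\<bar> \<noteq> \<infinity>" "0 < d"
    and "\<And>x'. norm (x' - x) < d \<Longrightarrow> h x + ereal (inner v (x' - x)) \<le> h x'"
  shows "v \<in> limiting_subdiff h x"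
proof -
  from assms(1) obtain r where r: "h x = ereal r" by auto
  have "v \<in> frechet_subdiff h x"
    unfolding frechet_subdiff_def
  proof (intro CollectI conjI allI impI)
    fix e :: real assume "0 < e"
    have "ereal (real_of_ereal (h x) + inner v (x' - x) - e * norm (x' - x)) \<le> h x'"
      if "norm (x' - x) < d" for x'
    proof -
      have "ereal (real_of_ereal (h x) + inner v (x' - x) - e * norm (x' - x)) \<le> h x + ereal (inner v (x' - x))"
        using \<open>0 < e\<close> by (simp add: r)
      also have "\<dots> \<le> h x'" using assms(3) that by blast
      finally show ?thesis .
    qed
    then show "\<exists>d>0. \<forall>x'. norm (x' - x) < d \<longrightarrow>
       ereal (real_of_ereal (h x) + inner v (x' - x) - e * norm (x' - x)) \<le> h x'"
      using assms(2) by blast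
  qed (use assms in auto)
  then show ?thesis unfolding limiting_subdiff_def
    by (intro CollectI exI[of _ "\<lambda>_. x"] exI[of _ "\<lambda>_. v"]) auto
qed

section \<open>Subdifferential and growth of the penalty\<close>

lemma Psi_plus_not_MInfty: "Psi_plus \<mu> z \<noteq> -\<infinity>"
  by (simp add: Psi_plus_def)

lemma Psi_plus_finite_iff: "Psi_plus \<mu> z < \<infinity> \<longleftrightarrow> (\<forall>i. 0 \<le> z $ i)"
  by (simp add: Psi_plus_def)

text \<open>Small changes of a positive coordinate, in either direction, leave the penalty
  unchanged, which forces the matching entry of v to be 0.\<close>

lemma frechet_subdiff_Psi_plus:
  assumes v: "v \<in> frechet_subdiff (Psi_plus \<mu>) z"
  shows "0 \<le> z $ i" "z $ i \<noteq> 0 \<Longrightarrow> v $ i = 0"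
proof -
  have fin: "\<bar>Psi_plus \<mu> z\<bar> \<noteq> \<infinity>" using v by (rule frechet_subdiffD)
  then have nn: "\<forall>i. 0 \<le> z $ i" by (auto simp: Psi_plus_def split: if_splits)
  then show "0 \<le> z $ i" by blast
  assume "z $ i \<noteq> 0"
  then have zi: "0 < z $ i" using nn by (simp add: less_le)
  have eq: "Psi_plus \<mu> (z + s *\<^sub>R axis i 1) = Psi_plus \<mu> z" if "\<bar>s\<bar> < z $ i" for s
  proof -
    have nz: "(z + s *\<^sub>R axis i 1) $ j \<noteq> 0 \<longleftrightarrow> z $ j \<noteq> 0" and pos: "0 \<le> (z + s *\<^sub>R axis i 1) $ j" for j
      using that nn zi by (auto simp: axis_def)
    show ?thesis unfolding Psi_plus_def nz using nn pos by simp
  qed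
  have small: "s * v $ i \<le> e * \<bar>s\<bar>" if "0 < e" "\<bar>s\<bar> = 1" for s e
  proof -
    from frechet_subdiffD(2)[OF v that(1)] obtain d where d: "0 < d"
      "\<And>y. norm (y - z) < d \<Longrightarrow>
        ereal (real_of_ereal (Psi_plus \<mu> z) + inner v (y - z) - e * norm (y - z)) \<le> Psi_plus \<mu> y"
      by blast
    define t where "t = min d (z $ i) / 2"
    have t: "0 < t" "t < d" "t < z $ i" using d zi by (auto simp: t_def)
    have ts: "\<bar>t * s\<bar> = t" using t that(2) by (simp add: abs_mult)
    have "ereal (real_of_ereal (Psi_plus \<mu> z) + t * s * v $ i - e * t) \<le> Psi_plus \<mu> z"
      using d(2)[of "z + (t * s) *\<^sub>R axis i 1"] t ts eq[of "t * s"]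
      by (simp add: inner_axis)
    then have "t * s * v $ i \<le> e * t"
      using fin by (cases "Psi_plus \<mu> z") auto
    then have "t * (s * v $ i) \<le> t * e" by (simp add: mult_ac)
    then show ?thesis using t that(2) by simp
  qed
  have "v $ i \<le> e" "- v $ i \<le> e" if "0 < e" for e
    using small[OF that, of 1] small[OF that, of "-1"] by auto
  then have "v $ i \<le> 0" "- v $ i \<le> 0"
    using field_le_epsilon[of "v $ i" 0] field_le_epsilon[of "- v $ i" 0] by auto
  then show "v $ i = 0" by simp
qed

text \<open>A coordinate that is nonzero in the limit is eventually nonzero along the sequence, so
  the matching entries of the Frechet subgradients are eventually 0.\<close>

lemma limiting_subdiff_Psi_plus:
  assumes v: "v \<in> limiting_subdiff (Psi_plus \<mu>) z"
  shows "0 \<le> z $ i" "z $ i \<noteq> 0 \<Longrightarrow> v $ i = 0"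
proof -
  obtain zs vs where zs: "zs \<longlonglongrightarrow> z"
    "\<And>k. vs k \<in> frechet_subdiff (Psi_plus \<mu>) (zs k)" "vs \<longlonglongrightarrow> v"
    using v unfolding limiting_subdiff_def by blast
  have lim: "(\<lambda>k. zs k $ i) \<longlonglongrightarrow> z $ i" "(\<lambda>k. vs k $ i) \<longlonglongrightarrow> v $ i"
    using zs by (auto intro: tendsto_vec_nth)
  show "0 \<le> z $ i"
    using frechet_subdiff_Psi_plus(1)[OF zs(2)] by (intro LIMSEQ_le_const[OF lim(1)]) auto
  assume "z $ i \<noteq> 0"
  then have "\<forall>\<^sub>F k in sequentially. zs k $ i \<noteq> 0" by (rule tendsto_imp_eventually_ne[OF lim(1)])
  then have "\<forall>\<^sub>F k in sequentially. vs k $ i = 0"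
    by eventually_elim (rule frechet_subdiff_Psi_plus(2)[OF zs(2)])
  then show "v $ i = 0"
    using LIMSEQ_unique[OF lim(2) tendsto_eventually] by blast
qed

text \<open>The estimate holds coordinatewise. It serves both directions: as the lower bound behind
  local minimality and as the proof that u is a limiting subgradient.\<close>

lemma Psi_plus_growth:
  assumes \<mu>: "\<forall>i. 0 < \<mu> $ i" and z: "\<forall>i. 0 \<le> z $ i" and u: "\<forall>i. z $ i \<noteq> 0 \<longrightarrow> u $ i = 0"
  shows "\<exists>d>0. \<forall>z'. norm (z' - z) < d \<longrightarrow> Psi_plus \<mu> z + ereal (inner u (z' - z)) \<le> Psi_plus \<mu> z'"
proof -
  \<comment> \<open>Within this radius a positive coordinate stays positive, and at a zero
    coordinate the linear term stays below the jump \<open>\<mu> $ i\<close>. The summand 1 covers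
    \<open>u $ i = 0\<close>.\<close>
  define D where "D i = (if z $ i \<noteq> 0 then z $ i else \<mu> $ i / (\<bar>u $ i\<bar> + 1))" for i
  define d where "d = Min (range D)"
  have D: "0 < D i" for i
    using \<mu> z by (auto simp: D_def less_le intro!: divide_pos_pos)
  then have "0 < d" by (auto simp: d_def)
  moreover have "Psi_plus \<mu> z + ereal (inner u (z' - z)) \<le> Psi_plus \<mu> z'" if "norm (z' - z) < d" for z'
  proof (cases "\<forall>i. 0 \<le> z' $ i")
    case True
    have "(if z $ i \<noteq> 0 then \<mu> $ i else 0) + u $ i * (z' - z) $ i \<le> (if z' $ i \<noteq> 0 then \<mu> $ i else 0)" for i
    proof -
      have "d \<le> D i" by (simp add: d_def)
      have "\<bar>(z' - z) $ i\<bar> < D i"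
        using component_le_norm_cart[of "z' - z" i] that \<open>d \<le> D i\<close> by linarith
      moreover have "u $ i * z' $ i \<le> \<mu> $ i" if "\<bar>z' $ i\<bar> < \<mu> $ i / (\<bar>u $ i\<bar> + 1)"
      proof -
        have "u $ i * z' $ i \<le> (\<bar>u $ i\<bar> + 1) * \<bar>z' $ i\<bar>"
          using abs_ge_self[of "u $ i * z' $ i"] by (simp add: abs_mult distrib_right)
        also have "\<dots> \<le> \<mu> $ i" using that by (simp add: pos_less_divide_eq mult.commute)
        finally show ?thesis .
      qed
      ultimately show ?thesis using u \<mu> z True
        by (auto simp: D_def split: if_splits)
    qed
    then have "(\<Sum>i\<in>UNIV. (if z $ i \<noteq> 0 then \<mu> $ i else 0) + u $ i * (z' - z) $ i)
        \<le> (\<Sum>i\<in>UNIV. if z' $ i \<noteq> 0 then \<mu> $ i else 0)"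
      by (intro sum_mono) simp
    then show ?thesis using True z
      by (simp add: Psi_plus_def inner_vec_def sum.distrib)
  qed (auto simp: Psi_plus_def)
  ultimately show ?thesis by blast
qed

section \<open>Stationarity and local minimality\<close>

text \<open>Otherwise the simplifier turns \<open>transpose M *v y\<close> into
  \<open>y v* M\<close>, and the adjoint rule below no longer applies.\<close>

declare transpose_matrix_vector [simp del]

lemma inner_transpose_mult: "inner x (transpose M *v y) = inner (M *v x) y"
  for M :: "real^'n^'m"
  by (metis dot_lmul_matrix inner_commute transpose_matrix_vector)

lemma stationary_imp_local_minimizer:
  fixes A :: "real^'n^'m" and B :: "real^'n^'r"
  assumes f: "proper_fun f" and g: "proper_fun g" and \<mu>: "\<forall>i. 0 < \<mu> $ i"
    and stat: "stationary_D f g A B b \<mu> (y, z)"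
  shows "local_minimizer (G_fun f g A B b \<mu>) (y, z)"
proof -
  define P where "P y z = - (transpose A *v y) - (transpose B *v z)" for y z
  obtain x v u where x: "x \<in> limiting_subdiff (conj_fun f) (P y z)"
    and v: "v \<in> limiting_subdiff (conj_fun g) y" and u: "u \<in> limiting_subdiff (Psi_plus \<mu>) z"
    and eq: "A *v x = v" "B *v x = b + u"
    using stat unfolding stationary_D_def P_def by auto
  note subf = limiting_subdiff_subgradient[OF convex_epigraph_conj_fun[OF f] conj_fun_not_MInfty[OF f] x]
  note subg = limiting_subdiff_subgradient[OF convex_epigraph_conj_fun[OF g] conj_fun_not_MInfty[OF g] v]
  have z: "\<forall>i. 0 \<le> z $ i" using limiting_subdiff_Psi_plus[OF u] by blast
  obtain d where d: "0 < d"
    "\<And>z'. norm (z' - z) < d \<Longrightarrow> Psi_plus \<mu> z + ereal (inner u (z' - z)) \<le> Psi_plus \<mu> z'"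
    using Psi_plus_growth[OF \<mu> z] limiting_subdiff_Psi_plus[OF u] by metis
  obtain r1 r2 r3 where r: "conj_fun f (P y z) = ereal r1" "conj_fun g y = ereal r2" "Psi_plus \<mu> z = ereal r3"
    using subf(1) subg(1) conj_fun_not_MInfty[OF f, of "P y z"] conj_fun_not_MInfty[OF g, of y] z
    by (cases "conj_fun f (P y z)"; cases "conj_fun g y") (auto simp: Psi_plus_def)
  have "G_fun f g A B b \<mu> (y, z) \<le> G_fun f g A B b \<mu> (y', z')" if "dist (y, z) (y', z') < d" for y' z'
  proof -
    have "norm (z' - z) < d"
      using dist_snd_le[of "(y, z)" "(y', z')"] that by (simp add: dist_norm norm_minus_commute)
    from d(2)[OF this] have 3: "Psi_plus \<mu> z + ereal (inner u (z' - z)) \<le> Psi_plus \<mu> z'" .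
    note 1 = subf(2)[of "P y' z'"] and 2 = subg(2)[of y']
    \<comment> \<open>By A x = v and B x = b + u the linear terms of the three subgradient
      inequalities cancel against the change of the term in b.\<close>
    have "inner x (P y' z' - P y z) = - inner v (y' - y) - inner (b + u) (z' - z)"
      unfolding P_def eq[symmetric] by (simp add: inner_diff_right inner_transpose_mult)
    then have sum0: "inner x (P y' z' - P y z) + inner v (y' - y) + inner u (z' - z) + inner b z' = inner b z"
      by (simp add: inner_add_left inner_diff_right)
    show ?thesis
      unfolding G_fun_def Xi_fun_def prod.case snd_conv P_def[symmetric]
      using 1 2 3 sum0 conj_fun_not_MInfty[OF f, of "P y' z'"] conj_fun_not_MInfty[OF g, of y']
        Psi_plus_not_MInfty[of \<mu> z'] unfolding r
      by (cases "conj_fun f (P y' z')"; cases "conj_fun g y'"; cases "Psi_plus \<mu> z'") auto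
  qed
  then show ?thesis unfolding local_minimizer_def using d(1) by (auto simp: mem_ball)
qed

section \<open>From local minimality to stationarity\<close>

lemma Psi_plus_cong_support:
  "(\<And>i. 0 \<le> z $ i \<longleftrightarrow> 0 \<le> z' $ i) \<Longrightarrow> (\<And>i. z $ i = 0 \<longleftrightarrow> z' $ i = 0) \<Longrightarrow> Psi_plus \<mu> z = Psi_plus \<mu> z'"
  by (simp add: Psi_plus_def)

text \<open>For small t the positive coordinates of zs stay positive, and its zero coordinates stay
  zero because z vanishes there.\<close>

lemma Psi_plus_segment:
  fixes z zs :: "real^'r"
  assumes zs: "\<forall>i. 0 \<le> zs $ i" and z: "\<forall>i. zs $ i = 0 \<longrightarrow> z $ i = 0"
  shows "\<forall>\<^sub>F t in at_right 0. Psi_plus \<mu> ((1 - t) *\<^sub>R zs + t *\<^sub>R z) = Psi_plus \<mu> zs"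
proof -
  have "\<forall>\<^sub>F t in at_right 0. zs $ i \<noteq> 0 \<longrightarrow> 0 < (1 - t) * zs $ i + t * z $ i" for i
  proof (cases "zs $ i = 0")
    case False
    have "((\<lambda>t. (1 - t) * zs $ i + t * z $ i) \<longlongrightarrow> (1 - 0) * zs $ i + 0 * z $ i) (at_right 0)"
      by (intro tendsto_intros)
    moreover have "0 < (1 - 0) * zs $ i + 0 * z $ i" using zs False by (simp add: less_le)
    ultimately show ?thesis by (auto dest: order_tendstoD(1) elim: eventually_mono)
  qed simp
  then have "\<forall>\<^sub>F t in at_right 0. \<forall>i. zs $ i \<noteq> 0 \<longrightarrow> 0 < (1 - t) * zs $ i + t * z $ i"
    by (rule eventually_all_finite)
  then show ?thesis
  proof eventually_elim
    case (elim t)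
    have "(0 \<le> ((1 - t) *\<^sub>R zs + t *\<^sub>R z) $ i \<longleftrightarrow> 0 \<le> zs $ i) \<and>
        (((1 - t) *\<^sub>R zs + t *\<^sub>R z) $ i = 0 \<longleftrightarrow> zs $ i = 0)" for i
      using elim[rule_format, of i] zs z by (cases "zs $ i = 0") auto
    then show ?case by (intro Psi_plus_cong_support) blast+
  qed
qed

text \<open>Local minimality is tested at a point close to (ys, zs) on the segment to (y, z). The
  penalty is the same at both points and cancels, convexity bounds the rest, and dividing by t gives
  the global inequality.\<close>

lemma local_minimizer_support_minimal:
  fixes A :: "real^'n^'m" and B :: "real^'n^'r"
  assumes f: "proper_fun f" and g: "proper_fun g"
    and min: "local_minimizer (G_fun f g A B b \<mu>) (ys, zs)"
    and r: "conj_fun f (- (transpose A *v ys) - (transpose B *v zs)) = ereal r1" "conj_fun g ys = ereal r2"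
    and zs: "\<forall>i. 0 \<le> zs $ i" and z: "\<forall>i. zs $ i = 0 \<longrightarrow> z $ i = 0"
    and le: "conj_fun f (- (transpose A *v y) - (transpose B *v z)) \<le> ereal \<alpha>" "conj_fun g y \<le> ereal \<beta>"
  shows "r1 + r2 + inner b zs \<le> \<alpha> + \<beta> + inner b z"
proof -
  define P where "P y z = - (transpose A *v y) - (transpose B *v z)" for y z
  obtain e where e: "0 < e" "\<And>w. dist (ys, zs) w < e \<Longrightarrow> G_fun f g A B b \<mu> (ys, zs) \<le> G_fun f g A B b \<mu> w"
    using min unfolding local_minimizer_def by auto
  define W where "W t = (1 - t) *\<^sub>R (ys, zs) + t *\<^sub>R (y, z)" for t :: real
  have "(W \<longlongrightarrow> (1 - 0) *\<^sub>R (ys, zs) + 0 *\<^sub>R (y, z)) (at_right 0)"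
    unfolding W_def by (intro tendsto_intros)
  then have "\<forall>\<^sub>F t in at_right 0. dist (W t) (ys, zs) < e" using e(1) by (auto dest: tendstoD)
  moreover have "\<forall>\<^sub>F t in at_right (0::real). t < 1 \<and> 0 < t"
    by (auto simp: eventually_at_right_field intro: exI[of _ 1])
  moreover note Psi_plus_segment[OF zs z, of \<mu>]
  \<comment> \<open>All smallness conditions on t hold eventually as t tends to 0 from the right, so
    a single t meets them all.\<close>
  ultimately have "\<forall>\<^sub>F t in at_right 0. dist (W t) (ys, zs) < e \<and> (t < 1 \<and> 0 < t) \<and>
      Psi_plus \<mu> ((1 - t) *\<^sub>R zs + t *\<^sub>R z) = Psi_plus \<mu> zs"
    by eventually_elim simp
  then obtain t where t: "dist (W t) (ys, zs) < e" "t < 1" "0 < t"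
    "Psi_plus \<mu> ((1 - t) *\<^sub>R zs + t *\<^sub>R z) = Psi_plus \<mu> zs"
    using eventually_happens'[of "at_right (0::real)"] by auto
  define y' z' where "y' = (1 - t) *\<^sub>R ys + t *\<^sub>R y" and "z' = (1 - t) *\<^sub>R zs + t *\<^sub>R z"
  have W: "W t = (y', z')" by (simp add: W_def y'_def z'_def)
  have P': "P y' z' = (1 - t) *\<^sub>R P ys zs + t *\<^sub>R P y z"
    by (simp add: P_def y'_def z'_def matrix_vector_right_distrib matrix_vector_mult_scaleR algebra_simps)
  have 1: "conj_fun f (P y' z') \<le> ereal ((1 - t) * r1 + t * \<alpha>)"
    unfolding P' by (rule epigraph_convexD[OF convex_epigraph_conj_fun[OF f]]) (use r le t in \<open>auto simp: P_def\<close>)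
  have 2: "conj_fun g y' \<le> ereal ((1 - t) * r2 + t * \<beta>)"
    unfolding y'_def by (rule epigraph_convexD[OF convex_epigraph_conj_fun[OF g]]) (use r le t in auto)
  obtain r3 where r3: "Psi_plus \<mu> zs = ereal r3" using zs by (simp add: Psi_plus_def)
  have "G_fun f g A B b \<mu> (ys, zs) \<le> G_fun f g A B b \<mu> (y', z')"
    using e(2)[of "(y', z')"] t(1) by (simp add: W dist_commute)
  then have "ereal (r1 + r2 + inner b zs + r3) \<le> conj_fun f (P y' z') + conj_fun g y' + ereal (inner b z') + ereal r3"
    using t(4) r r3 by (simp add: G_fun_def Xi_fun_def P_def z'_def)
  also have "\<dots> \<le> ereal ((1 - t) * r1 + t * \<alpha>) + ereal ((1 - t) * r2 + t * \<beta>) + ereal (inner b z') + ereal r3"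
    by (intro add_mono 1 2 order_refl)
  finally have "t * (r1 + r2 + inner b zs) \<le> t * (\<alpha> + \<beta> + inner b z)"
    by (simp add: z'_def inner_add_right algebra_simps)
  then show ?thesis using t by simp
qed

lemma local_minimizer_imp_stationary:
  fixes A :: "real^'n^'m" and B :: "real^'n^'r"
  assumes f: "proper_fun f" and g: "proper_fun g" and \<mu>: "\<forall>i. 0 < \<mu> $ i"
    and min: "local_minimizer (G_fun f g A B b \<mu>) (ys, zs)"
    and fin: "G_fun f g A B b \<mu> (ys, zs) < \<infinity>" and slater: "slater_D f g A B zs"
  shows "stationary_D f g A B b \<mu> (ys, zs)"
proof -
  define F G where "F = conj_fun f" and "G = conj_fun g"
  define ps where "ps = - (transpose A *v ys) - (transpose B *v zs)"
  have cvx: "convex (epigraph F)" "convex (epigraph G)"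
    unfolding F_def G_def using f g by (auto intro: convex_epigraph_conj_fun)
  have notM: "F p \<noteq> -\<infinity>" "G y \<noteq> -\<infinity>" for p y
    unfolding F_def G_def using f g by (auto simp: conj_fun_not_MInfty)
  obtain r1 r2 where r: "F ps = ereal r1" "G ys = ereal r2" and zs: "\<forall>i. 0 \<le> zs $ i"
    using fin notM(1)[of ps] notM(2)[of ys] Psi_plus_not_MInfty[of \<mu> zs] Psi_plus_finite_iff[of \<mu> zs]
    unfolding G_fun_def Xi_fun_def prod.case snd_conv F_def[symmetric] G_def[symmetric] ps_def[symmetric]
    by (cases "F ps"; cases "G ys"; cases "Psi_plus \<mu> zs") auto
  obtain y0 z0 where s0:
    "- (transpose A *v y0) - (transpose B *v z0) \<in> (if polyhedral_fun F then edom F else rel_interior (edom F))"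
    "y0 \<in> (if polyhedral_fun G then edom G else rel_interior (edom G))" "\<forall>i. zs $ i = 0 \<longrightarrow> z0 $ i = 0"
    using slater unfolding slater_D_def F_def G_def by blast
  obtain t1 t2 where
    "qualified_at (epigraph F) (- (transpose A *v y0) - (transpose B *v z0), t1)"
    "qualified_at (epigraph G) (y0, t2)"
    using qualified_at_epigraph[OF cvx(1) s0(1)] qualified_at_epigraph[OF cvx(2) s0(2)] by blast
  moreover have "qualified_at UNIV z0" by (rule qualified_at_rel_interior) auto
  ultimately have qual: "qualified_at ((epigraph F \<times> epigraph G) \<times> UNIV)
      (((- (transpose A *v y0) - (transpose B *v z0), t1), (y0, t2)), z0)"
    by (intro qualified_at_Times)
  \<comment> \<open>The kernel of K ties p to y and z as the argument of the conjugate of f, and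
    makes z vanish where zs does.\<close>
  define K :: "(((real^'n) \<times> real) \<times> ((real^'m) \<times> real)) \<times> (real^'r) \<Rightarrow> (real^'n) \<times> (real^'r)" where
    "K = (\<lambda>(((p, \<alpha>), (y, \<beta>)), z).
      (p + transpose A *v y + transpose B *v z, \<chi> i. if zs $ i = 0 then z $ i else 0))"
  \<comment> \<open>The excess over the value of \<Xi> at (ys, zs), made affine by using epigraph
    heights.\<close>
  define l :: "(((real^'n) \<times> real) \<times> ((real^'m) \<times> real)) \<times> (real^'r) \<Rightarrow> real" where
    "l = (\<lambda>(((p, \<alpha>), (y, \<beta>)), z). \<alpha> + \<beta> + inner b z - (r1 + r2 + inner b zs))"
  have linK: "linear K"
    by (rule linearI) (auto simp: K_def matrix_vector_right_distrib matrix_vector_mult_scaleR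
        scaleR_add_right vec_eq_iff split_beta)
  have K0: "K (((- (transpose A *v y0) - (transpose B *v z0), t1), (y0, t2)), z0) = 0"
    using s0(3) by (auto simp: K_def zero_prod_def vec_eq_iff)
  have affl: "affine_fun l"
    by (auto simp: affine_fun_def l_def inner_add_right algebra_simps)
  have nonneg: "0 \<le> l w" if w: "w \<in> (epigraph F \<times> epigraph G) \<times> UNIV" "K w = 0" for w
  proof -
    obtain p \<alpha> y \<beta> z where eq: "w = (((p, \<alpha>), (y, \<beta>)), z)" by (metis surj_pair)
    from w(2) have "p + transpose A *v y + transpose B *v z = 0" and z: "\<forall>i. zs $ i = 0 \<longrightarrow> z $ i = 0"
      by (auto simp: eq K_def zero_prod_def vec_eq_iff) metis
    then have "p = - (transpose A *v y) - (transpose B *v z)"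
      unfolding eq_diff_eq eq_neg_iff_add_eq_0 by (simp add: ac_simps)
    then show ?thesis
      using local_minimizer_support_minimal[OF f g min r[unfolded F_def G_def ps_def] zs z, of y \<alpha> \<beta>] w(1)
      by (simp add: eq l_def F_def G_def)
  qed
  obtain m where m: "\<forall>w\<in>(epigraph F \<times> epigraph G) \<times> UNIV. 0 \<le> l w + inner m (K w)"
    using qualified_linear_multiplier[OF qual linK K0 affl nonneg] by blast
  \<comment> \<open>The sign turns the multiplier of the first block of K into a subgradient of the
    conjugate of f.\<close>
  define x where "x = - fst m"
  \<comment> \<open>When z is supported where zs is nonzero, the second block of K vanishes and its
    multiplier drops out. The three inclusions follow by varying p, y and z one at a time.\<close>
  have key: "r1 + r2 + inner b zs \<le> \<alpha> + \<beta> + inner b z - inner x (p + transpose A *v y + transpose B *v z)"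
    if "F p \<le> ereal \<alpha>" "G y \<le> ereal \<beta>" "\<forall>i. zs $ i = 0 \<longrightarrow> z $ i = 0" for p \<alpha> y \<beta> z
  proof -
    have "(\<chi> i. if zs $ i = 0 then z $ i else 0) = 0" using that(3) by (auto simp: vec_eq_iff)
    then show ?thesis
      using m[rule_format, of "(((p, \<alpha>), (y, \<beta>)), z)"] that(1,2)
      by (auto simp: K_def l_def x_def inner_prod_def)
  qed
  have psz: "transpose A *v ys + transpose B *v zs = - ps" by (simp add: ps_def)
  have "F ps + ereal (inner x (p - ps)) \<le> F p" for p
  proof (cases "F p")
    case (real s)
    then show ?thesis
      using key[of p s ys r2 zs] r psz by (simp add: add.assoc)
  qed (use notM in auto)
  then have subF: "x \<in> limiting_subdiff F ps"
    using r by (intro limiting_subdiff_if_local_subgradient[of F ps 1]) auto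
  have "G ys + ereal (inner (A *v x) (y - ys)) \<le> G y" for y
  proof (cases "G y")
    case (real s)
    have "ps + transpose A *v y + transpose B *v zs = transpose A *v (y - ys)"
      by (simp add: ps_def matrix_vector_mult_diff_distrib)
    then show ?thesis
      using key[of ps r1 y s zs] r real by (simp add: inner_transpose_mult)
  qed (use notM in auto)
  then have subG: "A *v x \<in> limiting_subdiff G ys"
    using r by (intro limiting_subdiff_if_local_subgradient[of G ys 1]) auto
  define u where "u = B *v x - b"
  have u: "u $ i = 0" if "zs $ i \<noteq> 0" for i
  proof -
    \<comment> \<open>Moving zs along axis i keeps the support condition, since
      \<open>zs $ i\<close> is nonzero. A linear function of t that is never positive must
      vanish.\<close>
    have *: "t * u $ i \<le> 0" for t
    proof -
      have "ps + transpose A *v ys + transpose B *v (zs + t *\<^sub>R axis i 1) = transpose B *v (t *\<^sub>R axis i 1)"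
        by (simp add: ps_def matrix_vector_right_distrib)
      then have "0 \<le> inner b (t *\<^sub>R axis i 1) - inner x (transpose B *v (t *\<^sub>R axis i 1))"
        using key[of ps r1 ys r2 "zs + t *\<^sub>R axis i 1"] r that
        by (auto simp: inner_add_right axis_def)
      then show ?thesis
        unfolding inner_transpose_mult by (simp add: u_def inner_axis algebra_simps)
    qed
    from *[of 1] *[of "-1"] show ?thesis by simp
  qed
  have "u \<in> limiting_subdiff (Psi_plus \<mu>) zs"
  proof -
    obtain d where "0 < d"
      "\<And>z'. norm (z' - zs) < d \<Longrightarrow> Psi_plus \<mu> zs + ereal (inner u (z' - zs)) \<le> Psi_plus \<mu> z'"
      using Psi_plus_growth[OF \<mu> zs, of u] u by blast
    moreover have "\<bar>Psi_plus \<mu> zs\<bar> \<noteq> \<infinity>" using zs by (simp add: Psi_plus_def)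
    ultimately show ?thesis by (intro limiting_subdiff_if_local_subgradient)
  qed
  moreover have "B *v x = b + u" by (simp add: u_def)
  ultimately show ?thesis
    unfolding stationary_D_def prod.case using subF subG unfolding F_def G_def ps_def by blast
qed

theorem mainTheorem14:
  fixes f :: "real^'n \<Rightarrow> ereal" and g :: "real^'m \<Rightarrow> ereal"
    and A :: "real^'n^'m" and B :: "real^'n^'r" and b :: "real^'r" and \<mu> :: "real^'r"
  assumes "proper_fun f" "lsc_fun f" "convex_fun f"
    and "proper_fun g" "lsc_fun g" "convex_fun g"
    and "\<forall>i. 0 < \<mu> $ i"
  shows "(\<forall>w. stationary_D f g A B b \<mu> w \<longrightarrow> local_minimizer (G_fun f g A B b \<mu>) w)
    \<and> (\<forall>ys zs. local_minimizer (G_fun f g A B b \<mu>) (ys, zs)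
          \<and> G_fun f g A B b \<mu> (ys, zs) < \<infinity>
          \<and> slater_D f g A B zs
          \<longrightarrow> stationary_D f g A B b \<mu> (ys, zs))"
  using stationary_imp_local_minimizer[OF assms(1,4,7)] local_minimizer_imp_stationary[OF assms(1,4,7)]
  by (metis surj_pair)

end
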